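(* Let $X$ and $Y$ be finite-dimensional real inner product spaces, let $\mathsf{K}_h : X \to Y$ be a linear operator with a nontrivial nullspace $\mathcal{N}(\mathsf{K}_h)$, and let $\mathsf{P}: X \to \mathcal{N}(\mathsf{K}_h)^{\perp}$ denote the orthogonal projection onto the orthogonal complement of the nullspace of $\mathsf{K}_h$. Let $\{\phi_1, \phi_2, \ldots, \phi_n\}$ be an orthonormal basis of $X$ such that $\|\mathsf{P}\phi_i\|_X \neq 0$ for $i = 1, 2, \ldots, n$, and let $\mathsf{W}: X \to X$ be the linear operator defined by $$\mathsf{W}\phi_i = \|\mathsf{P}\phi_i\|_X\, \phi_i, \quad i = 1, 2, \ldots, n.$$ Let $j \in \{1, 2, \ldots, n\}$. Then the minimum norm least-squares solution $\mathbf{y}_j^*$ of $$\mathsf{K}_h \mathsf{W}^{-1} \mathbf{y} = \mathsf{K}_h \phi_j$$ satisfies $$\left\| \phi_j - \frac{\mathbf{y}_j^*}{\|\mathsf{P}\phi_j\|_X} \right\|_X \leq \left\| \phi_j - \mathsf{W}^{-1}\mathbf{x}_j^* \right\|_X,$$ where $\mathbf{x}_j^*$ is the minimum norm least-squares solution of $\mathsf{K}_h \mathbf{x} = \mathsf{K}_h \phi_j$, and $\mathsf{W}^{-1}\mathbf{x}_j^*$ can be written in the form $$\mathsf{W}^{-1} \mathbf{x}_j^* = \|\mathsf{P}\phi_j\|_X \sum_{i=1}^{n} \left( \frac{\mathsf{P}\phi_j}{\|\mathsf{P}\phi_j\|_X}, \frac{\mathsf{P}\phi_i}{\|\mathsf{P}\phi_i\|_X}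 \right)_X \phi_i.$$
   Context: $(\cdot,\cdot)_X$ and $\|\cdot\|_X$ denote the inner product and induced norm of $X$, and similarly for $Y$. For a linear operator $A: X \to Y$ and $\mathbf{b} \in Y$, the minimum norm least-squares solution of $A\mathbf{x} = \mathbf{b}$ is the element of smallest $X$-norm among all minimizers of $\|A \mathbf{x} - \mathbf{b}\|_Y$, i.e. $A^{\dagger}\mathbf{b}$, where $A^\dagger$ is the Moore-Penrose inverse. *)

theory Defs
  imports "HOL-Analysis.Analysis"
begin

definition null_space :: "('a::real_vector \<Rightarrow> 'b::real_vector) \<Rightarrow> 'a set" where
  "null_space A = {x. A x = 0}"

(* Well defined whenever S is a subspace of a Euclidean space. *)
definition orthogonal_projection :: "'a::euclidean_space set \<Rightarrow> 'a \<Rightarrow> 'a" where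
  "orthogonal_projection S x = (THE p. p \<in> S \<and> x - p \<in> S\<^sup>\<bottom>)"

definition orthonormal_basis :: "nat \<Rightarrow> (nat \<Rightarrow> 'a::euclidean_space) \<Rightarrow> bool" where
  "orthonormal_basis n \<phi> \<longleftrightarrow>
     (\<forall>i\<in>{1..n}. \<forall>k\<in>{1..n}. \<phi> i \<bullet> \<phi> k = (if i = k then 1 else 0)) \<and>
     span (\<phi> ` {1..n}) = UNIV"

definition least_squares_solutions ::
    "('a::euclidean_space \<Rightarrow> 'b::euclidean_space) \<Rightarrow> 'b \<Rightarrow> 'a set" where
  "least_squares_solutions A b = {x. \<forall>z. norm (A x - b) \<le> norm (A z - b)}"

(* Well defined whenever A is linear. *)
definition min_norm_least_squares_solution ::
    "('a::euclidean_space \<Rightarrow> 'b::euclidean_space) \<Rightarrow> 'b \<Rightarrow> 'a" where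
  "min_norm_least_squares_solution A b =
     (THE x. x \<in> least_squares_solutions A b \<and>
             (\<forall>z\<in>least_squares_solutions A b. norm x \<le> norm z))"

end

theory Submission
  imports Defs
begin

text \<open>Since \<open>K \<phi>\<^sub>j\<close> is attained, both least-squares problems are consistent, and a minimum norm
solution is the projection of any solution onto the orthogonal complement of the null space of
the operator: \<open>x\<^sup>* = P \<phi>\<^sub>j\<close>, and \<open>y\<^sup>*\<close> is the projection of \<open>W \<phi>\<^sub>j = \<parallel>P \<phi>\<^sub>j\<parallel> \<phi>\<^sub>j\<close> onto the
orthogonal complement \<open>S\<close> of the null space of \<open>K W\<^sup>-\<^sup>1\<close>. Hence \<open>y\<^sup>* / \<parallel>P \<phi>\<^sub>j\<parallel>\<close> is the best approximation
of \<open>\<phi>\<^sub>j\<close> in \<open>S\<close>. As \<open>W\<close> is self-adjoint, \<open>W\<^sup>-\<^sup>1 x\<^sup>*\<close> lies in \<open>S\<close> too, which gives the inequality.\<close>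

lemma subspace_null_space:
  assumes "linear A"
  shows "subspace (null_space A)"
  unfolding null_space_def using assms by (rule linear_subspace_kernel)

lemma orthogonal_compD:
  assumes "x \<in> S\<^sup>\<bottom>" "y \<in> S"
  shows "x \<bullet> y = 0"
  using assms by (auto simp: orthogonal_comp_def orthogonal_def inner_commute)

text \<open>The difference of two candidates lies in \<open>S\<close> and is orthogonal to itself.
  This is what lets the definite description in \<open>orthogonal_projection\<close> be
  evaluated.\<close>

lemma orthogonal_projection_unique:
  assumes "subspace S" "p \<in> S" "x - p \<in> S\<^sup>\<bottom>"
  shows "orthogonal_projection S x = p"
  unfolding orthogonal_projection_def
proof (rule the_equality)
  fix q assume q: "q \<in> S \<and> x - q \<in> S\<^sup>\<bottom>"
  have S: "q - p \<in> S" using assms q by (auto intro: subspace_diff)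
  then have "(x - p) \<bullet> (q - p) = 0" "(x - q) \<bullet> (q - p) = 0"
    using assms q orthogonal_compD by blast+
  then have "(q - p) \<bullet> (q - p) = 0" by (simp add: inner_diff_left)
  then show "q = p" by simp
qed (use assms in blast)

lemma orthogonal_projection:
  assumes "subspace S"
  shows "orthogonal_projection S x \<in> S" and "x - orthogonal_projection S x \<in> S\<^sup>\<bottom>"
proof -
  obtain p z where "p \<in> span S" "\<And>w. w \<in> span S \<Longrightarrow> orthogonal z w" "x = p + z"
    using orthogonal_subspace_decomp_exists by blast
  moreover have "span S = S" using assms by (simp add: span_eq_iff)
  ultimately have "p \<in> S" "x - p \<in> S\<^sup>\<bottom>"
    by (auto simp: orthogonal_comp_def orthogonal_commute)
  moreover from this have "orthogonal_projection S x = p"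
    using assms by (intro orthogonal_projection_unique)
  ultimately show "orthogonal_projection S x \<in> S" "x - orthogonal_projection S x \<in> S\<^sup>\<bottom>"
    by simp_all
qed

text \<open>Pythagoras: the residual is orthogonal to \<open>?p - s\<close>, which lies in
  \<open>S\<close>. The inequality of the theorem is the case
  \<open>s = inv W x_star\<close>.\<close>

lemma orthogonal_projection_le:
  assumes "subspace S" "s \<in> S"
  shows "norm (x - orthogonal_projection S x) \<le> norm (x - s)"
proof -
  let ?p = "orthogonal_projection S x"
  have "(x - ?p) \<bullet> (?p - s) = 0"
    using assms orthogonal_projection[OF assms(1)] by (intro orthogonal_compD) (auto intro: subspace_diff)
  then have "(norm ((x - ?p) + (?p - s)))\<^sup>2 = (norm (x - ?p))\<^sup>2 + (norm (?p - s))\<^sup>2"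
    by (intro norm_add_Pythagorean) (simp add: orthogonal_def)
  then have "(norm (x - ?p))\<^sup>2 \<le> (norm (x - s))\<^sup>2" by simp
  then show ?thesis by (rule power2_le_imp_le) simp
qed

lemma orthogonal_projection_scaleR:
  assumes "subspace S"
  shows "orthogonal_projection S (c *\<^sub>R x) = c *\<^sub>R orthogonal_projection S x"
proof (rule orthogonal_projection_unique[OF assms])
  show "c *\<^sub>R orthogonal_projection S x \<in> S"
    using orthogonal_projection(1)[OF assms] assms by (simp add: subspace_scale)
  have "c *\<^sub>R (x - orthogonal_projection S x) \<in> S\<^sup>\<bottom>"
    using orthogonal_projection(2)[OF assms] by (simp add: subspace_scale subspace_orthogonal_comp)
  then show "c *\<^sub>R x - c *\<^sub>R orthogonal_projection S x \<in> S\<^sup>\<bottom>"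
    by (simp add: scaleR_diff_right)
qed

text \<open>The residual of \<open>x\<close> is orthogonal to \<open>s\<close>. This later turns
  \<open>\<phi> i\<close> into \<open>P (\<phi> i)\<close> inside the coefficients of the
  expansion.\<close>

lemma inner_orthogonal_projection:
  assumes "subspace S" "s \<in> S"
  shows "s \<bullet> orthogonal_projection S x = s \<bullet> x"
  using orthogonal_compD[OF orthogonal_projection(2)[OF assms(1)] assms(2), of x]
  by (simp add: inner_diff_left inner_commute[of s])

text \<open>The point \<open>u\<close> attains residual zero, so every minimizer must attain it as
  well.\<close>

lemma least_squares_solutions_consistent:
  "least_squares_solutions A (A u) = {x. A x = A u}"
proof -
  have "A x = A u" if "\<forall>z. norm (A x - A u) \<le> norm (A z - A u)" for x
    using that[rule_format, of u] by simp
  then show ?thesis by (auto simp: least_squares_solutions_def)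
qed

text \<open>Every solution is \<open>?p\<close> plus a null vector, and \<open>?p\<close> is
  orthogonal to null vectors. By Pythagoras, \<open>?p\<close> has the smallest norm, and equality
  forces the null vector to vanish.\<close>

lemma min_norm_least_squares_solution_consistent:
  fixes A :: "'a::euclidean_space \<Rightarrow> 'b::euclidean_space"
  assumes "linear A"
  shows "min_norm_least_squares_solution A (A u) = orthogonal_projection ((null_space A)\<^sup>\<bottom>) u"
proof -
  let ?N = "null_space A"
  let ?p = "orthogonal_projection (?N\<^sup>\<bottom>) u"
  have p: "?p \<in> ?N\<^sup>\<bottom>" "u - ?p \<in> ?N"
    \<comment> \<open>The residual lies in the double complement of \<open>?N\<close>, which is
      \<open>?N\<close> itself.\<close>
    using orthogonal_projection[OF subspace_orthogonal_comp[of ?N], of u]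
    by (simp_all add: orthogonal_comp_self subspace_null_space assms)
  have Ap: "A ?p = A u"
    using p(2) by (simp add: null_space_def linear_diff[OF assms])
  have pyth: "(norm z)\<^sup>2 = (norm ?p)\<^sup>2 + (norm (z - ?p))\<^sup>2" if "A z = A u" for z
  proof -
    have "z - ?p \<in> ?N" using that Ap by (simp add: null_space_def linear_diff[OF assms])
    then have "orthogonal ?p (z - ?p)" using p(1) by (simp add: orthogonal_def orthogonal_compD)
    from norm_add_Pythagorean[OF this] show ?thesis by simp
  qed
  show ?thesis
    unfolding min_norm_least_squares_solution_def least_squares_solutions_consistent
  proof (rule the_equality)
    have "norm ?p \<le> norm z" if "A z = A u" for z
      by (rule power2_le_imp_le) (simp_all add: pyth[OF that])
    then show "?p \<in> {x. A x = A u} \<and> (\<forall>z\<in>{x. A x = A u}. norm ?p \<le> norm z)"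
      using Ap by simp
  next
    fix x assume x: "x \<in> {x. A x = A u} \<and> (\<forall>z\<in>{x. A x = A u}. norm x \<le> norm z)"
    then have "(norm x)\<^sup>2 \<le> (norm ?p)\<^sup>2" using Ap by (intro power_mono) auto
    then have "(norm (x - ?p))\<^sup>2 \<le> 0" using pyth x by fastforce
    then show "x = ?p" by simp
  qed
qed

lemma orthonormal_basis_expansion:
  assumes "orthonormal_basis n \<phi>"
  shows "(\<Sum>i=1..n. (x \<bullet> \<phi> i) *\<^sub>R \<phi> i) = x"
proof -
  have on: "\<phi> i \<bullet> \<phi> k = (if i = k then 1 else 0)" if "i \<in> {1..n}" "k \<in> {1..n}" for i k
    using assms that by (simp add: orthonormal_basis_def)
  \<comment> \<open>The library expansion sums over a set of vectors; injectivity allows reindexing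
    it by \<open>{1..n}\<close>. Equal vectors at distinct indices would have inner product both 0
    and 1.\<close>
  have inj: "inj_on \<phi> {1..n}"
    by (rule inj_onI) (metis on zero_neq_one)
  have "(\<Sum>b\<in>\<phi> ` {1..n}. (x \<bullet> b) *\<^sub>R b) = x"
  proof (rule orthonormal_basis_expand)
    show "pairwise orthogonal (\<phi> ` {1..n})"
      by (auto simp: pairwise_def orthogonal_def on)
    show "norm b = 1" if "b \<in> \<phi> ` {1..n}" for b
      using that by (auto simp: norm_eq_1 on)
    show "x \<in> span (\<phi> ` {1..n})" using assms by (simp add: orthonormal_basis_def)
  qed simp
  then show ?thesis by (simp only: sum.reindex[OF inj] o_def)
qed

text \<open>The right-hand side is symmetric in \<open>x\<close> and \<open>y\<close>, so
  self-adjointness of \<open>W\<close> can be read off from it.\<close>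

lemma inner_diagonal:
  assumes "orthonormal_basis n \<phi>" "linear W"
    and eig: "\<And>i. i \<in> {1..n} \<Longrightarrow> W (\<phi> i) = w i *\<^sub>R \<phi> i"
  shows "W x \<bullet> y = (\<Sum>i=1..n. w i * (x \<bullet> \<phi> i) * (y \<bullet> \<phi> i))"
proof -
  have "W x = W (\<Sum>i=1..n. (x \<bullet> \<phi> i) *\<^sub>R \<phi> i)"
    using orthonormal_basis_expansion[OF assms(1)] by simp
  also have "\<dots> = (\<Sum>i=1..n. (x \<bullet> \<phi> i) *\<^sub>R w i *\<^sub>R \<phi> i)"
    by (simp add: linear_sum[OF assms(2)] linear_cmul[OF assms(2)] eig)
  finally show ?thesis
    by (simp only: inner_sum_left inner_scaleR_left inner_commute[of y] mult_ac)
qed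

lemma self_adjoint_diagonal:
  assumes "orthonormal_basis n \<phi>" "linear W"
    and "\<And>i. i \<in> {1..n} \<Longrightarrow> W (\<phi> i) = w i *\<^sub>R \<phi> i"
  shows "W x \<bullet> y = x \<bullet> W y"
proof -
  have "W u \<bullet> v = (\<Sum>i=1..n. w i * (u \<bullet> \<phi> i) * (v \<bullet> \<phi> i))" for u v
    using assms by (rule inner_diagonal)
  then have "W x \<bullet> y = W y \<bullet> x" by (simp only: mult_ac)
  then show ?thesis by (simp add: inner_commute)
qed

text \<open>If \<open>W x = 0\<close>, self-adjointness gives
  \<open>w i * (x \<bullet> \<phi> i) = 0\<close>, so all coordinates of \<open>x\<close> vanish.
  Injectivity yields surjectivity in finite dimension.\<close>

lemma bij_diagonal:
  assumes "orthonormal_basis n \<phi>" "linear W"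
    and eig: "\<And>i. i \<in> {1..n} \<Longrightarrow> W (\<phi> i) = w i *\<^sub>R \<phi> i"
    and nz: "\<And>i. i \<in> {1..n} \<Longrightarrow> w i \<noteq> 0"
  shows "bij (W :: 'a::euclidean_space \<Rightarrow> 'a)"
proof -
  have "x = 0" if "W x = 0" for x
  proof -
    have "x \<bullet> \<phi> i = 0" if i: "i \<in> {1..n}" for i
      using self_adjoint_diagonal[OF assms(1-3), of x "\<phi> i"] \<open>W x = 0\<close> nz[OF i]
      by (simp add: eig[OF i])
    then have "(\<Sum>i=1..n. (x \<bullet> \<phi> i) *\<^sub>R \<phi> i) = 0" by simp
    then show "x = 0" by (simp only: orthonormal_basis_expansion[OF assms(1)])
  qed
  then have "inj W" using assms(2) by (simp add: linear_injective_0)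
  then show ?thesis using assms(2) by (simp add: bij_def linear_injective_imp_surjective)
qed

theorem theorem4p3:
  fixes K :: "'a::euclidean_space \<Rightarrow> 'b::euclidean_space"
    and P W :: "'a \<Rightarrow> 'a"
    and \<phi> :: "nat \<Rightarrow> 'a"
    and n j :: nat
    and x_star y_star :: 'a
  assumes "linear K"
    and "null_space K \<noteq> {0}"
    and "P = orthogonal_projection ((null_space K)\<^sup>\<bottom>)"
    and "orthonormal_basis n \<phi>"
    and "\<And>i. i \<in> {1..n} \<Longrightarrow> norm (P (\<phi> i)) \<noteq> 0"
    and "linear W"
    and "\<And>i. i \<in> {1..n} \<Longrightarrow> W (\<phi> i) = norm (P (\<phi> i)) *\<^sub>R \<phi> i"
    and "j \<in> {1..n}"
    and "y_star = min_norm_least_squares_solution (\<lambda>y. K (inv W y)) (K (\<phi> j))"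
    and "x_star = min_norm_least_squares_solution K (K (\<phi> j))"
  shows "norm (\<phi> j - y_star /\<^sub>R norm (P (\<phi> j))) \<le> norm (\<phi> j - inv W x_star) \<and>
         inv W x_star =
           norm (P (\<phi> j)) *\<^sub>R
             (\<Sum>i=1..n. ((P (\<phi> j) /\<^sub>R norm (P (\<phi> j))) \<bullet> (P (\<phi> i) /\<^sub>R norm (P (\<phi> i)))) *\<^sub>R \<phi> i)"
proof -
  let ?N = "null_space K" and ?w = "\<lambda>i. norm (P (\<phi> i))"
  let ?B = "\<lambda>y. K (inv W y)"
  let ?S = "(null_space ?B)\<^sup>\<bottom>"
  note diag = assms(4,6,7)
  have bij: "bij W" using bij_diagonal[OF diag assms(5)] .
  have W_inv: "W (inv W x) = x" for x using bij by (simp add: bij_def surj_f_inv_f)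
  have inv_W: "inv W (W x) = x" for x using bij by (simp add: bij_def)
  have lin_inv: "linear (inv W)"
    using assms(6) bij by (simp add: bij_def inj_linear_imp_inv_linear)
  have lin_B: "linear ?B"
    using linear_compose[OF lin_inv assms(1)] by (simp add: o_def)
  have P_in: "P x \<in> ?N\<^sup>\<bottom>" for x
    by (simp add: assms(3) orthogonal_projection(1) subspace_orthogonal_comp)
  have x_star: "x_star = P (\<phi> j)"
    by (simp add: assms(1,3,10) min_norm_least_squares_solution_consistent)
  have w_j: "?w j \<noteq> 0" using assms(5,8) .
  \<comment> \<open>Writing \<open>K (\<phi> j)\<close> as a value of \<open>?B\<close> shows that
    the weighted problem is consistent, with solution \<open>W (\<phi> j)\<close>.\<close>
  have "y_star = min_norm_least_squares_solution ?B (?B (W (\<phi> j)))"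
    by (simp add: assms(9) inv_W)
  also have "\<dots> = ?w j *\<^sub>R orthogonal_projection ?S (\<phi> j)"
    by (simp add: min_norm_least_squares_solution_consistent[OF lin_B] assms(7)[OF assms(8)]
        orthogonal_projection_scaleR subspace_orthogonal_comp)
  finally have y_star: "y_star /\<^sub>R ?w j = orthogonal_projection ?S (\<phi> j)"
    using w_j by simp
  have "inv W x_star \<in> ?S"
  proof -
    have "inv W x_star \<bullet> z = 0" if "z \<in> null_space ?B" for z
    proof -
      \<comment> \<open>The inverse inherits self-adjointness: apply that of \<open>W\<close> to the
        preimages of \<open>x_star\<close> and \<open>z\<close>.\<close>
      have "inv W x_star \<bullet> z = x_star \<bullet> inv W z"
        using self_adjoint_diagonal[OF diag, of "inv W x_star" "inv W z"] by (simp add: W_inv)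
      also have "\<dots> = 0"
        \<comment> \<open>Membership of \<open>z\<close> in the null space of \<open>?B\<close>
          means that \<open>inv W z\<close> lies in \<open>?N\<close>, to which
          \<open>P (\<phi> j)\<close> is orthogonal.\<close>
        using that orthogonal_compD[OF P_in] by (simp add: x_star null_space_def)
      finally show ?thesis .
    qed
    then show ?thesis by (simp add: orthogonal_comp_def orthogonal_def inner_commute)
  qed
  then have "norm (\<phi> j - y_star /\<^sub>R ?w j) \<le> norm (\<phi> j - inv W x_star)"
    unfolding y_star by (intro orthogonal_projection_le subspace_orthogonal_comp)
  moreover have "inv W x_star = ?w j *\<^sub>R
      (\<Sum>i=1..n. ((P (\<phi> j) /\<^sub>R ?w j) \<bullet> (P (\<phi> i) /\<^sub>R ?w i)) *\<^sub>R \<phi> i)"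
  proof -
    have coeff: "inv W x_star \<bullet> \<phi> i = (P (\<phi> j) \<bullet> P (\<phi> i)) / ?w i" if i: "i \<in> {1..n}" for i
    proof -
      \<comment> \<open>Moving \<open>W\<close> onto its eigenvector \<open>\<phi> i\<close> pulls
        out the eigenvalue \<open>?w i\<close>.\<close>
      have "?w i * (inv W x_star \<bullet> \<phi> i) = x_star \<bullet> \<phi> i"
        using self_adjoint_diagonal[OF diag, of "inv W x_star" "\<phi> i"]
        by (simp add: W_inv assms(7)[OF i])
      also have "\<dots> = P (\<phi> j) \<bullet> P (\<phi> i)"
        using inner_orthogonal_projection[OF subspace_orthogonal_comp P_in, of "\<phi> j" "\<phi> i"]
        by (simp add: x_star flip: assms(3))
      finally show ?thesis using assms(5)[OF i] by (simp add: field_simps)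
    qed
    have "inv W x_star = (\<Sum>i=1..n. (inv W x_star \<bullet> \<phi> i) *\<^sub>R \<phi> i)"
      by (simp only: orthonormal_basis_expansion[OF assms(4)])
    \<comment> \<open>The factor \<open>?w j\<close> is introduced only to cancel the normalization
      of \<open>P (\<phi> j)\<close>.\<close>
    also have "\<dots> = (\<Sum>i=1..n. ?w j *\<^sub>R
        ((P (\<phi> j) /\<^sub>R ?w j) \<bullet> (P (\<phi> i) /\<^sub>R ?w i)) *\<^sub>R \<phi> i)"
      by (intro sum.cong refl) (use w_j in \<open>simp add: coeff divide_inverse mult_ac\<close>)
    finally show ?thesis by (simp only: scaleR_sum_right)
  qed
  ultimately show ?thesis ..
qed

end
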